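(* For the space $H^\infty$ the minimal errors satisfy the following. For $k=0$ and all integers $n\ge1$, $$e(n,0,\infty)\le\frac1{2^{n-1}\,n!}.$$ For $k\in\mathbb{Z}$, $k\ne0$, and all even integers $n\ge2$, $$e(n,k,\infty)\le\min\left(\frac1{2^{n-1}\,n!},\ \frac1{(2\pi|k|)^{n/2}}\right).$$
   Context: $H^\infty=\{f\in C^\infty([0,1]) : f \text{ complex-valued},\ \sum_{\ell=0}^\infty\|f^{(\ell)}\|_{L_2}^2<\infty\}$, where $\|\cdot\|_{L_2}$ is the norm of $L_2([0,1])$, equipped with the inner product $\langle f,g\rangle_\infty=\sum_{\ell=0}^\infty\int_0^1 f^{(\ell)}(x)\,dx\ \int_0^1\overline{g^{(\ell)}(x)}\,dx$ and norm $\|f\|_{H^\infty}=\langle f,f\rangle_\infty^{1/2}$. For $k\in\mathbb{Z}$, $I_k(f)=\int_0^1 f(x)\,e^{-2\pi i kx}\,dx$. Algorithms using $n$ function or derivative values have the form $A_n(f)=\sum_{j=1}^n a_j f^{(\ell_j)}(x_j)$ with $a_j\in\mathbb{C}$, $\ell_j\in\{0,1,2,\dots\}$, $x_j\in[0,1]$ (which may depend on $k$ and $n$), and the $n$th minimal worst case error is $e(n,k,\infty)=\inf_{A_n}\sup\{|I_k(f)-A_n(f)| : f\in H^\infty,\ \|f\|_{H^\infty}\le1\}$. *)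

theory Defs
  imports "HOL-Analysis.Analysis"
begin

text \<open>
  Functions on \<open>[0,1]\<close> are represented by total functions \<open>real \<Rightarrow> complex\<close>. Every notion below only
  looks at the values on \<open>{0..1}\<close>; at the end points derivatives are one-sided.
\<close>

primrec nth_deriv :: "nat \<Rightarrow> (real \<Rightarrow> complex) \<Rightarrow> real \<Rightarrow> complex" where
  "nth_deriv 0 f = f"
| "nth_deriv (Suc l) f = (\<lambda>x. vector_derivative (nth_deriv l f) (at x within {0..1}))"

definition smooth01 :: "(real \<Rightarrow> complex) \<Rightarrow> bool" where
  "smooth01 f \<longleftrightarrow> (\<forall>l. nth_deriv l f differentiable_on {0..1})"

text \<open>
  Only applied to functions that are continuous on \<open>{0..1}\<close>, where the Henstock--Kurzweil and the
  Lebesgue integral agree.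
\<close>

definition L2_norm01 :: "(real \<Rightarrow> complex) \<Rightarrow> real" where
  "L2_norm01 f = sqrt (integral {0..1} (\<lambda>x. (cmod (f x))\<^sup>2))"

definition H_inf :: "(real \<Rightarrow> complex) set" where
  "H_inf = {f. smooth01 f \<and> summable (\<lambda>l. (L2_norm01 (nth_deriv l f))\<^sup>2)}"

definition inner_H_inf :: "(real \<Rightarrow> complex) \<Rightarrow> (real \<Rightarrow> complex) \<Rightarrow> complex" where
  "inner_H_inf f g =
     (\<Sum>l. integral {0..1} (nth_deriv l f) * integral {0..1} (\<lambda>x. cnj (nth_deriv l g x)))"

text \<open>
  For \<open>f \<in> H_inf\<close> the series \<open>inner_H_inf f f\<close> converges (by Cauchy--Schwarz) to a nonnegative real
  number, so taking the real part loses nothing.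
\<close>

definition norm_H_inf :: "(real \<Rightarrow> complex) \<Rightarrow> real" where
  "norm_H_inf f = sqrt (Re (inner_H_inf f f))"

definition osc_integral :: "int \<Rightarrow> (real \<Rightarrow> complex) \<Rightarrow> complex" where
  "osc_integral k f = integral {0..1} (\<lambda>x. f x * exp (- 2 * of_real pi * \<i> * of_int k * of_real x))"

definition algorithms :: "nat \<Rightarrow> ((real \<Rightarrow> complex) \<Rightarrow> complex) set" where
  "algorithms n = {A. \<exists>(a :: nat \<Rightarrow> complex) (l :: nat \<Rightarrow> nat) (x :: nat \<Rightarrow> real).
     (\<forall>j\<in>{1..n}. x j \<in> {0..1}) \<and> A = (\<lambda>f. \<Sum>j=1..n. a j * nth_deriv (l j) f (x j))}"

text \<open>
  Errors are extended reals, so that the supremum and the infimum are meaningful without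
  a boundedness argument.
\<close>

definition worst_case_error :: "int \<Rightarrow> ((real \<Rightarrow> complex) \<Rightarrow> complex) \<Rightarrow> ereal" where
  "worst_case_error k A =
     (SUP f\<in>{f \<in> H_inf. norm_H_inf f \<le> 1}. ereal (cmod (osc_integral k f - A f)))"

definition minimal_error :: "nat \<Rightarrow> int \<Rightarrow> ereal" where
  "minimal_error n k = (INF A\<in>algorithms n. worst_case_error k A)"

end

theory Submission
  imports Defs
begin

text \<open>
  The norm of \<open>H_inf\<close> sees only the means \<open>c\<^sub>l\<close> of the derivatives of \<open>f\<close>: its square is the sum of the
  \<open>(cmod c\<^sub>l)\<^sup>2\<close>. The key fact is that on the unit ball this already forces every derivative to be
  bounded by 2 on the whole interval (\<open>cmod_nth_deriv_le_2\<close>). A function differs from its mean by at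
  most half of a bound for its derivative, because the average of \<open>\<bar>x - t\<bar>\<close> over \<open>t\<close> is at most 1/2;
  as all means have modulus at most 1, iterating this gives
  \<open>cmod (nth_deriv l f x) \<le> 1 + 1/2 + 1/4 + \<dots>\<close>. The iteration leaves a rest of \<open>(1/2) ^ M\<close> times a bound
  for the derivative of order \<open>l + M\<close>, and this vanishes because the summability of the
  \<open>L\<^sub>2\<close>-norms in the definition of \<open>H_inf\<close> bounds all derivatives uniformly
  (\<open>nth_deriv_uniformly_bounded\<close>).

  Both upper bounds then come from explicit algorithms. Integrating the Taylor polynomial of degree
  \<open>n - 1\<close> at the midpoint against the oscillating factor uses \<open>n\<close> derivative values, and its error
  is at most the supremum of the Taylor remainder, \<open>2 * (1/2) ^ n / fact n\<close>, for every frequency.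
  For \<open>k \<noteq> 0\<close>, integrating by parts \<open>m\<close> times uses the derivatives of orders below \<open>m\<close> at both end
  points, hence \<open>2 * m\<close> values; the boundary terms form the algorithm, since the oscillating factor
  is 1 at both ends. The error is an oscillatory integral of the \<open>m\<close>-th derivative, divided
  by a number of modulus \<open>(2 * pi * \<bar>k\<bar>) ^ m\<close>. The supremum bound would only give 2 for that integral; one further
  integration by parts gives the bound 1 (\<open>cmod_integral_nth_deriv_osc_le_1\<close>).
\<close>

section \<open>Integral estimates on the unit interval\<close>

lemma norm_integral_01_le:
  fixes h :: "real \<Rightarrow> 'a::euclidean_space"
  assumes "continuous_on {0..1} h" and "\<And>x. x \<in> {0..1} \<Longrightarrow> norm (h x) \<le> B"
  shows "norm (integral {0..1} h) \<le> B"
proof -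
  have "norm (integral {0..1} h) \<le> integral {0..1} (\<lambda>x::real. B)"
    by (intro integral_norm_bound_integral integrable_continuous_real continuous_on_const assms)
  then show ?thesis by simp
qed

lemma integral_abs_diff_le:
  fixes x :: real
  assumes "x \<in> {0..1}"
  shows "integral {0..1} (\<lambda>t. \<bar>x - t\<bar>) \<le> 1 / 2"
proof -
  have "((\<lambda>t. \<bar>x - t\<bar>) has_integral x\<^sup>2 / 2) {0..x}"
  proof -
    have "((\<lambda>t. x - t) has_integral (x * x - x\<^sup>2 / 2) - (x * 0 - 0\<^sup>2 / 2)) {0..x}"
      using assms
      by (intro fundamental_theorem_of_calculus)
         (auto intro!: derivative_eq_intros
            simp: has_real_derivative_iff_has_vector_derivative [symmetric])
    then have "((\<lambda>t. x - t) has_integral x\<^sup>2 / 2) {0..x}"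
      by (simp add: power2_eq_square)
    then show ?thesis by (rule has_integral_eq [rotated]) auto
  qed
  moreover have "((\<lambda>t. \<bar>x - t\<bar>) has_integral (1 - x)\<^sup>2 / 2) {x..1}"
  proof -
    have "((\<lambda>t. t - x) has_integral (1\<^sup>2 / 2 - x * 1) - (x\<^sup>2 / 2 - x * x)) {x..1}"
      using assms
      by (intro fundamental_theorem_of_calculus)
         (auto intro!: derivative_eq_intros
            simp: has_real_derivative_iff_has_vector_derivative [symmetric])
    then have "((\<lambda>t. t - x) has_integral (1 - x)\<^sup>2 / 2) {x..1}"
      by (simp add: power2_eq_square field_simps)
    then show ?thesis by (rule has_integral_eq [rotated]) auto
  qed
  ultimately have "integral {0..1} (\<lambda>t. \<bar>x - t\<bar>) = x\<^sup>2 / 2 + (1 - x)\<^sup>2 / 2"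
    using assms by (intro integral_unique has_integral_combine [of 0 x 1]) auto
  also have "\<dots> = 1 / 2 - x * (1 - x)" by (simp add: power2_eq_square field_simps)
  also have "\<dots> \<le> 1 / 2" using assms by simp
  finally show ?thesis .
qed

text \<open>
  The Cauchy--Schwarz inequality against the constant 1, in its variance form: the integral of
  \<open>(cmod (h x) - m)\<^sup>2\<close> is nonnegative, where \<open>m\<close> is the mean of \<open>cmod \<circ> h\<close>.
\<close>

lemma integral_norm_le_L2_norm01:
  assumes "continuous_on {0..1} h"
  shows "integral {0..1} (\<lambda>x. cmod (h x)) \<le> L2_norm01 h"
proof -
  define m where "m = integral {0..1} (\<lambda>x. cmod (h x))"
  have cm: "(\<lambda>x. cmod (h x)) integrable_on {0..1}"
    by (intro integrable_continuous_real continuous_intros assms)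
  have c2: "(\<lambda>x. (cmod (h x))\<^sup>2) integrable_on {0..1}"
    by (intro integrable_continuous_real continuous_intros assms)
  have "((\<lambda>x. (cmod (h x))\<^sup>2 - 2 * m * cmod (h x) + m\<^sup>2) has_integral
      integral {0..1} (\<lambda>x. (cmod (h x))\<^sup>2) - 2 * m * m + m\<^sup>2) {0..1}"
    using cm c2 has_integral_const_real [of "m\<^sup>2" 0 1] unfolding m_def
    by (intro has_integral_add has_integral_diff has_integral_mult_right integrable_integral) auto
  moreover have "(cmod (h x))\<^sup>2 - 2 * m * cmod (h x) + m\<^sup>2 \<ge> 0" for x
    using zero_le_power2 [of "cmod (h x) - m"] by (simp add: power2_eq_square algebra_simps)
  ultimately have "0 \<le> integral {0..1} (\<lambda>x. (cmod (h x))\<^sup>2) - 2 * m * m + m\<^sup>2"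
    by (rule has_integral_nonneg)
  then have "m\<^sup>2 \<le> integral {0..1} (\<lambda>x. (cmod (h x))\<^sup>2)"
    by (simp add: power2_eq_square)
  then show ?thesis
    unfolding L2_norm01_def m_def [symmetric] by (rule real_le_rsqrt)
qed

lemma cmod_integral_le_L2_norm01:
  assumes "continuous_on {0..1} h"
  shows "cmod (integral {0..1} h) \<le> L2_norm01 h"
proof -
  have "cmod (integral {0..1} h) \<le> integral {0..1} (\<lambda>x. cmod (h x))"
    by (intro integral_norm_bound_integral integrable_continuous_real continuous_intros assms) auto
  then show ?thesis using integral_norm_le_L2_norm01 [OF assms] by linarith
qed

text \<open>
  On an interval of length 1 the deviation of \<open>h x\<close> from the mean of \<open>h\<close> is itself the mean of the
  differences \<open>h x - h t\<close>. This is used with two majorants: \<open>B * \<bar>x - t\<bar>\<close> from a bound on the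
  derivative, and a constant, the \<open>L\<^sub>1\<close>-norm of the derivative.
\<close>

lemma norm_minus_mean_le:
  fixes h :: "real \<Rightarrow> 'a::euclidean_space"
  assumes h: "continuous_on {0..1} h" and g: "continuous_on {0..1} g"
    and le: "\<And>t. t \<in> {0..1} \<Longrightarrow> norm (h x - h t) \<le> g t"
  shows "norm (h x) \<le> norm (integral {0..1} h) + integral {0..1} g"
proof -
  have "((\<lambda>t. h x - h t) has_integral h x - integral {0..1} h) {0..1}"
    using has_integral_const_real [of "h x" 0 1] h
    by (intro has_integral_diff integrable_integral integrable_continuous_real) auto
  then have "h x - integral {0..1} h = integral {0..1} (\<lambda>t. h x - h t)"
    by (simp add: integral_unique)
  also have "norm \<dots> \<le> integral {0..1} g"
    by (intro integral_norm_bound_integral integrable_continuous_real continuous_intros h g le)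
  finally show ?thesis
    using norm_triangle_ineq2 [of "h x" "integral {0..1} h"] by linarith
qed

text \<open>
  The contraction step. The factor 1/2, which makes the iteration converge, is the maximum of the
  mean of \<open>\<bar>x - t\<bar>\<close> over \<open>t\<close>, attained at the end points; the bound \<open>\<bar>x - t\<bar> \<le> 1\<close> alone would
  give no contraction.
\<close>

lemma norm_le_mean_plus_half:
  fixes h :: "real \<Rightarrow> complex"
  assumes D: "\<And>t. t \<in> {0..1} \<Longrightarrow> (h has_vector_derivative h' t) (at t within {0..1})"
    and B: "\<And>t. t \<in> {0..1} \<Longrightarrow> cmod (h' t) \<le> B" and x: "x \<in> {0..1}"
  shows "cmod (h x) \<le> cmod (integral {0..1} h) + B / 2"
proof -
  have ch: "continuous_on {0..1} h"
    using D by (rule continuous_on_vector_derivative)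
  have B0: "B \<ge> 0" using B [OF x] norm_ge_zero [of "h' x"] by linarith
  have "cmod (h x - h t) \<le> B * \<bar>x - t\<bar>" if "t \<in> {0..1}" for t
    unfolding real_norm_def [symmetric]
  proof (rule differentiable_bound [where S = "{0..1}" and f' = "\<lambda>t s. s *\<^sub>R h' t"])
    show "onorm (\<lambda>s. s *\<^sub>R h' u) \<le> B" if "u \<in> {0..1}" for u
      using B [OF that] by (intro onorm_le) (simp add: mult.commute [of B] mult_left_mono)
  qed (use D x that in \<open>auto simp: has_vector_derivative_def\<close>)
  then have "cmod (h x) \<le> cmod (integral {0..1} h) + integral {0..1} (\<lambda>t. B * \<bar>x - t\<bar>)"
    by (intro norm_minus_mean_le ch continuous_intros)
  also have "integral {0..1} (\<lambda>t. B * \<bar>x - t\<bar>) \<le> B * (1 / 2)"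
    using integral_abs_diff_le [OF x] B0 unfolding integral_mult_right by (rule mult_left_mono)
  finally show ?thesis by simp
qed

lemma norm_le_L2_norms:
  fixes h :: "real \<Rightarrow> complex"
  assumes D: "\<And>t. t \<in> {0..1} \<Longrightarrow> (h has_vector_derivative h' t) (at t within {0..1})"
    and h': "continuous_on {0..1} h'" and x: "x \<in> {0..1}"
  shows "cmod (h x) \<le> L2_norm01 h + L2_norm01 h'"
proof -
  have ch: "continuous_on {0..1} h"
    using D by (rule continuous_on_vector_derivative)
  have less: "cmod (h b - h a) \<le> integral {0..1} (\<lambda>s. cmod (h' s))"
    if ab: "0 \<le> a" "a \<le> b" "b \<le> 1" for a b
  proof -
    have sub: "{a..b} \<subseteq> {0..1}" using ab by auto
    have "(h' has_integral h b - h a) {a..b}"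
      using ab by (intro fundamental_theorem_of_calculus
          has_vector_derivative_within_subset [OF D sub]) auto
    then have "h b - h a = integral {a..b} h'" by (simp add: integral_unique)
    also have "cmod \<dots> \<le> integral {a..b} (\<lambda>s. cmod (h' s))"
      by (intro integral_norm_bound_integral integrable_continuous_real continuous_intros
          continuous_on_subset [OF h' sub]) auto
    also have "\<dots> \<le> integral {0..1} (\<lambda>s. cmod (h' s))"
      by (intro integral_subset_le sub integrable_continuous_real continuous_intros
          continuous_on_subset [OF h' sub] h') auto
    finally show ?thesis .
  qed
  have "cmod (h x) \<le> cmod (integral {0..1} h) +
      integral {0..1} (\<lambda>t::real. integral {0..1} (\<lambda>s. cmod (h' s)))"
  proof (rule norm_minus_mean_le [OF ch continuous_on_const])
    fix t :: real assume "t \<in> {0..1}"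
    then show "cmod (h x - h t) \<le> integral {0..1} (\<lambda>s. cmod (h' s))"
      using less [of x t] less [of t x] x by (cases "t \<le> x") (auto simp: norm_minus_commute)
  qed
  then show ?thesis
    using cmod_integral_le_L2_norm01 [OF ch] integral_norm_le_L2_norm01 [OF h'] by simp
qed

section \<open>Derivatives of functions in the unit ball\<close>

lemma nth_deriv_has_vector_derivative:
  assumes "smooth01 f" "x \<in> {0..1}"
  shows "(nth_deriv l f has_vector_derivative nth_deriv (Suc l) f x) (at x within {0..1})"
  using assms by (auto simp: smooth01_def differentiable_on_def vector_derivative_works)

lemma continuous_on_nth_deriv:
  "smooth01 f \<Longrightarrow> continuous_on {0..1} (nth_deriv l f)"
  by (simp add: smooth01_def differentiable_imp_continuous_on)

lemma integral_nth_deriv_Suc: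
  assumes "smooth01 f"
  shows "integral {0..1} (nth_deriv (Suc l) f) = nth_deriv l f 1 - nth_deriv l f 0"
  using assms
  by (intro integral_unique fundamental_theorem_of_calculus nth_deriv_has_vector_derivative) auto

text \<open>
  The squared norm is the sum of the squared moduli of the means, so each of them is at most 1. This
  needs the series to converge, which follows by comparison with the series of \<open>L\<^sub>2\<close>-norms.
\<close>

lemma cmod_integral_nth_deriv_le_1:
  assumes f: "f \<in> H_inf" and n: "norm_H_inf f \<le> 1"
  shows "cmod (integral {0..1} (nth_deriv l f)) \<le> 1"
proof -
  let ?c = "\<lambda>l. (cmod (integral {0..1} (nth_deriv l f)))\<^sup>2"
  have sm: "smooth01 f" and su: "summable (\<lambda>l. (L2_norm01 (nth_deriv l f))\<^sup>2)"
    using f by (auto simp: H_inf_def)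
  have le: "?c l \<le> (L2_norm01 (nth_deriv l f))\<^sup>2" for l
    by (intro power_mono cmod_integral_le_L2_norm01 continuous_on_nth_deriv sm norm_ge_zero)
  have sc: "summable ?c"
    by (rule summable_comparison_test' [OF su, of 0]) (use le in auto)
  have "inner_H_inf f f = (\<Sum>l. complex_of_real (?c l))"
    unfolding inner_H_inf_def integral_cnj [symmetric] complex_norm_square by simp
  also have "\<dots> = complex_of_real (suminf ?c)"
    by (rule suminf_of_real [OF sc, symmetric])
  finally have "norm_H_inf f = sqrt (suminf ?c)" by (simp add: norm_H_inf_def)
  with n have "suminf ?c \<le> 1" by simp
  moreover have "?c l \<le> suminf ?c"
    using sum_le_suminf [OF sc, of "{l}"] by simp
  ultimately have "?c l \<le> 1\<^sup>2" by simp
  then show ?thesis by (rule power2_le_imp_le) simp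
qed

lemma nth_deriv_uniformly_bounded:
  assumes "f \<in> H_inf"
  obtains C where "C \<ge> 0" "\<And>l x. x \<in> {0..1} \<Longrightarrow> cmod (nth_deriv l f x) \<le> C"
proof -
  have sm: "smooth01 f" and su: "summable (\<lambda>l. (L2_norm01 (nth_deriv l f))\<^sup>2)"
    using assms by (auto simp: H_inf_def)
  define K where "K = 1 + (\<Sum>l. (L2_norm01 (nth_deriv l f))\<^sup>2)"
  have K: "L2_norm01 (nth_deriv l f) \<le> K" for l
  proof -
    have "(L2_norm01 (nth_deriv l f))\<^sup>2 \<le> (\<Sum>l. (L2_norm01 (nth_deriv l f))\<^sup>2)"
      using sum_le_suminf [OF su, of "{l}"] by simp
    moreover have "y \<le> 1 + y\<^sup>2" for y :: real
      using zero_le_power2 [of "y - 1/2"] by (simp add: power2_eq_square algebra_simps)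
    ultimately show ?thesis unfolding K_def by (meson add_left_mono order_trans)
  qed
  have "cmod (nth_deriv l f x) \<le> 2 * K" if "x \<in> {0..1}" for l x
  proof -
    have "cmod (nth_deriv l f x) \<le> L2_norm01 (nth_deriv l f) + L2_norm01 (nth_deriv (Suc l) f)"
      by (rule norm_le_L2_norms)
        (use that sm nth_deriv_has_vector_derivative continuous_on_nth_deriv in blast)+
    then show ?thesis using K [of l] K [of "Suc l"] by linarith
  qed
  moreover have "0 \<le> 2 * K"
    unfolding K_def using suminf_nonneg [OF su] by simp
  ultimately show ?thesis using that by blast
qed

text \<open>
  The supremum bound on the unit ball. The bound 2 is the fixed point of \<open>y \<mapsto> 1 + y / 2\<close>, the map
  that turns a common bound for all derivatives into a better one.
\<close>

lemma cmod_nth_deriv_le_2: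
  assumes f: "f \<in> H_inf" and n: "norm_H_inf f \<le> 1" and x: "x \<in> {0..1}"
  shows "cmod (nth_deriv l f x) \<le> 2"
proof -
  have sm: "smooth01 f" using f by (simp add: H_inf_def)
  obtain C where "C \<ge> 0" and C: "\<And>l x. x \<in> {0..1} \<Longrightarrow> cmod (nth_deriv l f x) \<le> C"
    using nth_deriv_uniformly_bounded [OF f] by blast
  have bd: "cmod (nth_deriv l f x) \<le> 2 + C / 2 ^ M" if "x \<in> {0..1}" for M l x
    using that
  proof (induction M arbitrary: l x)
    case 0
    then show ?case using C [of x l] by simp
  next
    case (Suc M)
    have "cmod (nth_deriv l f x) \<le>
        cmod (integral {0..1} (nth_deriv l f)) + (2 + C / 2 ^ M) / 2"
      by (rule norm_le_mean_plus_half [OF nth_deriv_has_vector_derivative [OF sm] Suc.IH])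
        (use Suc.prems in auto)
    also have "\<dots> \<le> 1 + (2 + C / 2 ^ M) / 2"
      using cmod_integral_nth_deriv_le_1 [OF f n] by simp
    finally show ?case by (simp add: field_simps)
  qed
  have "(\<lambda>M. 2 + C / 2 ^ M) \<longlonglongrightarrow> 2 + 0"
    by (intro tendsto_intros LIMSEQ_divide_realpow_zero) auto
  then have "(\<lambda>M. 2 + C / 2 ^ M) \<longlonglongrightarrow> 2" by simp
  then show ?thesis by (rule LIMSEQ_le_const) (use bd [OF x] in blast)
qed

section \<open>The Taylor algorithm\<close>

text \<open>
  The sequence \<open>F\<close> stands for the successive derivatives of \<open>F 0\<close>. Parametrising the segment from
  \<open>a\<close> to \<open>x\<close> by the unit interval reduces the claim to Taylor's formula with integral remainder
  on \<open>{0..1}\<close>, at once for \<open>x\<close> on either side of \<open>a\<close>.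
\<close>

lemma norm_Taylor_remainder_le:
  fixes F :: "nat \<Rightarrow> real \<Rightarrow> 'a::banach"
  assumes S: "convex S" "a \<in> S" "x \<in> S"
    and D: "\<And>i t. i < n \<Longrightarrow> t \<in> S \<Longrightarrow> (F i has_vector_derivative F (Suc i) t) (at t within S)"
    and B: "\<And>t. t \<in> S \<Longrightarrow> norm (F n t) \<le> B"
  shows "norm (F 0 x - (\<Sum>i<n. ((x - a) ^ i / fact i) *\<^sub>R F i a)) \<le> B * \<bar>x - a\<bar> ^ n / fact n"
proof (cases "n = 0")
  case True
  then show ?thesis using B [OF S(3)] by simp
next
  case False
  define p where "p s = a + s * (x - a)" for s :: real
  define G where "G i s = (x - a) ^ i *\<^sub>R F i (p s)" for i s
  have p: "p s \<in> S" if "s \<in> {0..1}" for s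
  proof -
    have "p s = (1 - s) *\<^sub>R a + s *\<^sub>R x" by (simp add: p_def algebra_simps)
    then show ?thesis using convexD [OF S(1) S(2) S(3), of "1 - s" s] that by simp
  qed
  have DG: "(G i has_vector_derivative G (Suc i) s) (at s within {0..1})"
    if "i < n" "0 \<le> s" "s \<le> 1" for i s
  proof -
    have "(p has_vector_derivative (x - a)) (at s within {0..1})"
      unfolding p_def by (auto intro!: derivative_eq_intros)
    moreover have "(F i has_vector_derivative F (Suc i) (p s)) (at (p s) within p ` {0..1})"
      by (rule has_vector_derivative_within_subset [OF D]) (use p that in auto)
    ultimately have "((F i \<circ> p) has_vector_derivative ((x - a) *\<^sub>R F (Suc i) (p s)))
        (at s within {0..1})"
      by (rule vector_diff_chain_within)
    then have "((\<lambda>s. (x - a) ^ i *\<^sub>R (F i \<circ> p) s) has_vector_derivative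
        (x - a) ^ i *\<^sub>R ((x - a) *\<^sub>R F (Suc i) (p s))) (at s within {0..1})"
      by (rule bounded_linear.has_vector_derivative [OF bounded_linear_scaleR_right])
    then show ?thesis by (simp add: G_def [abs_def] o_def mult.commute)
  qed
  have int: "((\<lambda>s. ((1 - s) ^ (n - 1) / fact (n - 1)) *\<^sub>R G n s) has_integral
      G 0 1 - (\<Sum>i<n. ((1 - 0) ^ i / fact i) *\<^sub>R G i 0)) {0..1}"
    by (rule Taylor_has_integral) (use False DG in auto)
  have G: "G 0 1 - (\<Sum>i<n. ((1 - 0) ^ i / fact i) *\<^sub>R G i 0) =
      F 0 x - (\<Sum>i<n. ((x - a) ^ i / fact i) *\<^sub>R F i a)"
    by (simp add: G_def p_def)
  let ?E = "\<lambda>s::real. - ((1 - s) ^ n / fact n) * (B * \<bar>x - a\<bar> ^ n)"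
  have "((\<lambda>s. (1 - s) ^ (n - 1) / fact (n - 1) * (B * \<bar>x - a\<bar> ^ n)) has_integral
      ?E 1 - ?E 0) {0..1}"
  proof (rule fundamental_theorem_of_calculus)
    obtain m where m: "n = Suc m" using False by (cases n) auto
    show "(?E has_vector_derivative (1 - s) ^ (n - 1) / fact (n - 1) * (B * \<bar>x - a\<bar> ^ n))
        (at s within {0..1})" for s
      unfolding has_real_derivative_iff_has_vector_derivative [symmetric] m
      by (rule derivative_eq_intros refl | simp add: divide_simps)+
  qed simp
  then have bound: "((\<lambda>s. (1 - s) ^ (n - 1) / fact (n - 1) * (B * \<bar>x - a\<bar> ^ n)) has_integral
      B * \<bar>x - a\<bar> ^ n / fact n) {0..1}"
    using False by (simp add: power_0_left)
  have "norm (integral {0..1} (\<lambda>s. ((1 - s) ^ (n - 1) / fact (n - 1)) *\<^sub>R G n s)) \<le>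
      integral {0..1} (\<lambda>s. (1 - s) ^ (n - 1) / fact (n - 1) * (B * \<bar>x - a\<bar> ^ n))"
  proof (rule integral_norm_bound_integral)
    fix s :: real assume s: "s \<in> {0..1}"
    have "norm (G n s) \<le> B * \<bar>x - a\<bar> ^ n"
      using B [OF p [OF s]] by (simp add: G_def power_abs mult.commute mult_right_mono)
    then show "norm (((1 - s) ^ (n - 1) / fact (n - 1)) *\<^sub>R G n s)
        \<le> (1 - s) ^ (n - 1) / fact (n - 1) * (B * \<bar>x - a\<bar> ^ n)"
      using s by (simp add: divide_right_mono mult_left_mono power_abs)
  qed (use int bound in \<open>auto simp: has_integral_iff\<close>)
  then show ?thesis
    using integral_unique [OF int] integral_unique [OF bound] G by simp
qed

definition osc :: "int \<Rightarrow> real \<Rightarrow> complex" where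
  "osc k x = exp (- 2 * of_real pi * \<i> * of_int k * of_real x)"

lemma cmod_osc [simp]: "cmod (osc k x) = 1"
  by (simp add: osc_def)

lemma continuous_on_osc [continuous_intros]: "continuous_on S (osc k)"
  unfolding osc_def by (intro continuous_intros)

lemma osc_0 [simp]: "osc k 0 = 1"
  by (simp add: osc_def)

lemma osc_1 [simp]: "osc k 1 = 1"
  unfolding osc_def exp_eq_1 by (auto intro!: exI [of _ "- k"])

lemma minimal_error_le:
  assumes "A \<in> algorithms n"
    and "\<And>f. f \<in> H_inf \<Longrightarrow> norm_H_inf f \<le> 1 \<Longrightarrow> cmod (osc_integral k f - A f) \<le> e"
  shows "minimal_error n k \<le> ereal e"
proof -
  have "worst_case_error k A \<le> ereal e"
    unfolding worst_case_error_def by (rule SUP_least) (use assms(2) in auto)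
  then show ?thesis
    unfolding minimal_error_def by (rule INF_lower2 [OF assms(1)])
qed

text \<open>
  The midpoint is the best centre: it keeps \<open>\<bar>x - 1/2\<bar> \<le> 1/2\<close> on the interval. The factor 2 from
  the supremum bound for the \<open>n\<close>-th derivative turns \<open>2 ^ n\<close> into \<open>2 ^ (n - 1)\<close>.
\<close>

lemma minimal_error_le_Taylor:
  assumes "n \<ge> 1"
  shows "minimal_error n k \<le> ereal (1 / (2 ^ (n - 1) * fact n))"
proof -
  define w where "w i = integral {0..1} (\<lambda>x. ((x - 1/2) ^ i / fact i) *\<^sub>R osc k x)" for i :: nat
  define A where "A f = (\<Sum>j=1..n. w (j - 1) * nth_deriv (j - 1) f (1/2))" for f
  show ?thesis
  proof (rule minimal_error_le)
    show "A \<in> algorithms n"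
      unfolding algorithms_def mem_Collect_eq
      by (rule exI [of _ "\<lambda>j. w (j - 1)"], rule exI [of _ "\<lambda>j. j - 1"], rule exI [of _ "\<lambda>_. 1/2"])
        (auto simp: A_def)
  next
    fix f assume f: "f \<in> H_inf" and nf: "norm_H_inf f \<le> 1"
    have sm: "smooth01 f" using f by (simp add: H_inf_def)
    have cf: "continuous_on {0..1} f" using continuous_on_nth_deriv [OF sm, of 0] by simp
    let ?T = "\<lambda>x. \<Sum>i<n. ((x - 1/2) ^ i / fact i) *\<^sub>R nth_deriv i f (1/2)"
    have "A f = (\<Sum>i<n. w i * nth_deriv i f (1/2))"
      unfolding A_def by (rule sum.reindex_bij_witness [of _ Suc "\<lambda>j. j - 1"]) auto
    also have "((\<lambda>x. \<Sum>i<n. ((x - 1/2) ^ i / fact i) *\<^sub>R osc k x * nth_deriv i f (1/2))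
        has_integral \<dots>) {0..1}"
      unfolding w_def
      by (intro has_integral_sum has_integral_mult_left integrable_integral
          integrable_continuous_real continuous_intros) auto
    also have "(\<lambda>x. \<Sum>i<n. ((x - 1/2) ^ i / fact i) *\<^sub>R osc k x * nth_deriv i f (1/2)) =
        (\<lambda>x. ?T x * osc k x)"
      by (simp add: sum_distrib_left mult_ac)
    finally have A: "((\<lambda>x. ?T x * osc k x) has_integral A f) {0..1}" .
    have "((\<lambda>x. f x * osc k x) has_integral osc_integral k f) {0..1}"
      unfolding osc_integral_def osc_def [symmetric]
      by (intro integrable_integral integrable_continuous_real continuous_intros cf)
    from has_integral_diff [OF this A]
    have I: "osc_integral k f - A f = integral {0..1} (\<lambda>x. (f x - ?T x) * osc k x)"
      by (simp add: left_diff_distrib integral_unique)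
    also have "cmod \<dots> \<le> 2 * (1/2) ^ n / fact n"
    proof (rule norm_integral_01_le)
      show "continuous_on {0..1} (\<lambda>x. (f x - ?T x) * osc k x)"
        by (intro continuous_intros cf) auto
      fix x :: real assume x: "x \<in> {0..1}"
      have "cmod (nth_deriv 0 f x - ?T x) \<le> 2 * \<bar>x - 1/2\<bar> ^ n / fact n"
        by (rule norm_Taylor_remainder_le [where S = "{0..1}"])
          (use x cmod_nth_deriv_le_2 [OF f nf] nth_deriv_has_vector_derivative [OF sm] in auto)
      also have "\<dots> \<le> 2 * (1/2) ^ n / fact n"
        using x by (intro divide_right_mono mult_left_mono power_mono) (auto simp: abs_if)
      finally show "cmod ((f x - ?T x) * osc k x) \<le> 2 * (1/2) ^ n / fact n"
        by (simp add: norm_mult)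
    qed
    also have "2 * (1/2) ^ n / fact n = 1 / (2 ^ (n - 1) * (fact n :: real))"
      using assms by (cases n) (simp_all add: field_simps)
    finally show "cmod (osc_integral k f - A f) \<le> 1 / (2 ^ (n - 1) * fact n)" .
  qed
qed

section \<open>The algorithm from integration by parts\<close>

lemma integral_times_osc_by_parts:
  assumes D: "\<And>x. x \<in> {0..1} \<Longrightarrow> (g has_vector_derivative g' x) (at x within {0..1})"
    and g': "continuous_on {0..1} g'" and "k \<noteq> 0"
  shows "integral {0..1} (\<lambda>x. g x * osc k x) =
    (integral {0..1} (\<lambda>x. g' x * osc k x) - (g 1 - g 0)) / (2 * of_real pi * \<i> * of_int k)"
proof -
  let ?q = "2 * of_real pi * \<i> * of_int k"
  have q: "?q \<noteq> 0" using assms(3) by simp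
  have cg: "continuous_on {0..1} g"
    using D by (rule continuous_on_vector_derivative)
  have "(osc k has_vector_derivative - ?q * osc k x) (at x within {0..1})" for x
    unfolding osc_def [abs_def]
    by (rule derivative_eq_intros has_vector_derivative_real_field refl | simp)+
  then have "((\<lambda>x. g x * osc k x) has_vector_derivative
      g x * (- ?q * osc k x) + g' x * osc k x) (at x within {0..1})" if "x \<in> {0..1}" for x
    using D [OF that] by (rule has_vector_derivative_mult [rotated])
  then have 1: "((\<lambda>x. g x * (- ?q * osc k x) + g' x * osc k x) has_integral
      g 1 * osc k 1 - g 0 * osc k 0) {0..1}"
    by (intro fundamental_theorem_of_calculus) auto
  have 2: "((\<lambda>x. - ?q * (g x * osc k x) + g' x * osc k x) has_integral
      - ?q * integral {0..1} (\<lambda>x. g x * osc k x) + integral {0..1} (\<lambda>x. g' x * osc k x)) {0..1}"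
    by (intro has_integral_add has_integral_mult_right integrable_integral
        integrable_continuous_real continuous_intros cg g')
  have 3: "(\<lambda>x. g x * (- ?q * osc k x) + g' x * osc k x) =
      (\<lambda>x. - ?q * (g x * osc k x) + g' x * osc k x)" by (simp add: algebra_simps)
  have "g 1 - g 0 =
      - ?q * integral {0..1} (\<lambda>x. g x * osc k x) + integral {0..1} (\<lambda>x. g' x * osc k x)"
    using has_integral_unique [OF 1 [unfolded 3] 2] by (simp only: osc_0 osc_1 mult_1_right)
  then show ?thesis using q by (simp only: nonzero_eq_divide_eq) (simp add: algebra_simps)
qed

lemma osc_integral_expansion:
  assumes sm: "smooth01 f" and k: "k \<noteq> 0"
  defines "q \<equiv> 2 * of_real pi * \<i> * of_int k"
  shows "osc_integral k f =
    (\<Sum>i<m. (nth_deriv i f 0 - nth_deriv i f 1) / q ^ Suc i) +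
    integral {0..1} (\<lambda>x. nth_deriv m f x * osc k x) / q ^ m"
proof (induction m)
  case 0
  then show ?case by (simp add: osc_integral_def osc_def)
next
  case (Suc m)
  have "integral {0..1} (\<lambda>x. nth_deriv m f x * osc k x) =
      (integral {0..1} (\<lambda>x. nth_deriv (Suc m) f x * osc k x) -
        (nth_deriv m f 1 - nth_deriv m f 0)) / q"
    unfolding q_def using nth_deriv_has_vector_derivative [OF sm] continuous_on_nth_deriv [OF sm] k
    by (rule integral_times_osc_by_parts)
  then show ?case
    using Suc.IH by (simp add: diff_divide_distrib add_divide_distrib del: nth_deriv.simps)
qed

text \<open>
  One integration by parts replaces the integral by \<open>?I - ?c\<close> divided by \<open>?q\<close>. Here \<open>?I\<close> has
  modulus at most 2 by the supremum bound, and the boundary term \<open>?c\<close> is the mean of the next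
  derivative, of modulus at most 1; the denominator has modulus at least \<open>2 * pi > 3\<close>.
\<close>

lemma cmod_integral_nth_deriv_osc_le_1:
  assumes f: "f \<in> H_inf" and nf: "norm_H_inf f \<le> 1" and k: "k \<noteq> 0"
  shows "cmod (integral {0..1} (\<lambda>x. nth_deriv m f x * osc k x)) \<le> 1"
proof -
  have sm: "smooth01 f" using f by (simp add: H_inf_def)
  let ?q = "2 * complex_of_real pi * \<i> * of_int k"
  let ?I = "integral {0..1} (\<lambda>x. nth_deriv (Suc m) f x * osc k x)"
  let ?c = "integral {0..1} (nth_deriv (Suc m) f)"
  have "integral {0..1} (\<lambda>x. nth_deriv m f x * osc k x) = (?I - ?c) / ?q"
    unfolding integral_nth_deriv_Suc [OF sm]
    using nth_deriv_has_vector_derivative [OF sm] continuous_on_nth_deriv [OF sm] k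
    by (rule integral_times_osc_by_parts)
  moreover have "cmod (?I - ?c) \<le> 3"
  proof -
    have "cmod ?I \<le> 2"
      using cmod_nth_deriv_le_2 [OF f nf]
      by (intro norm_integral_01_le continuous_intros continuous_on_nth_deriv sm)
        (simp add: norm_mult del: nth_deriv.simps)
    then show ?thesis
      using cmod_integral_nth_deriv_le_1 [OF f nf, of "Suc m"] norm_triangle_ineq4 [of ?I ?c]
      by linarith
  qed
  moreover have "3 \<le> cmod ?q"
  proof -
    have "1 \<le> \<bar>real_of_int k\<bar>" using k by linarith
    then have "6 * 1 \<le> (2 * pi) * \<bar>real_of_int k\<bar>"
      using pi_gt3 by (intro mult_mono) auto
    then show ?thesis by (simp add: norm_mult)
  qed
  ultimately show ?thesis by (simp add: norm_divide divide_le_eq)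
qed

lemma endpoint_algorithm_in_algorithms:
  "(\<lambda>f. \<Sum>i<m. b i * (nth_deriv i f 0 - nth_deriv i f 1)) \<in> algorithms (2 * m)"
proof -
  \<comment> \<open>The nodes \<open>2 * i + 1\<close> and \<open>2 * i + 2\<close> carry the \<open>i\<close>-th derivative at 0 and at 1.\<close>
  have *: "(\<Sum>j=1..2 * m. (if odd j then b ((j - 1) div 2) else - b ((j - 1) div 2)) *
        nth_deriv ((j - 1) div 2) f (if odd j then 0 else 1)) =
      (\<Sum>i<m. b i * (nth_deriv i f 0 - nth_deriv i f 1))" for f
    by (induction m) (simp_all add: algebra_simps)
  show ?thesis
    unfolding algorithms_def mem_Collect_eq
    by (rule exI [of _ "\<lambda>j. if odd j then b ((j - 1) div 2) else - b ((j - 1) div 2)"],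
        rule exI [of _ "\<lambda>j. (j - 1) div 2"], rule exI [of _ "\<lambda>j. if odd j then 0 else 1"])
      (intro conjI ballI ext * [symmetric], simp)
qed

lemma minimal_error_le_by_parts:
  assumes k: "k \<noteq> 0"
  shows "minimal_error (2 * m) k \<le> ereal (1 / (2 * pi * real_of_int \<bar>k\<bar>) ^ m)"
proof (rule minimal_error_le [OF endpoint_algorithm_in_algorithms])
  let ?q = "2 * complex_of_real pi * \<i> * of_int k"
  fix f assume f: "f \<in> H_inf" and nf: "norm_H_inf f \<le> 1"
  have sm: "smooth01 f" using f by (simp add: H_inf_def)
  have "osc_integral k f - (\<Sum>i<m. 1 / ?q ^ Suc i * (nth_deriv i f 0 - nth_deriv i f 1)) =
      integral {0..1} (\<lambda>x. nth_deriv m f x * osc k x) / ?q ^ m"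
    using osc_integral_expansion [OF sm k, of m] by simp
  also have "cmod \<dots> \<le> 1 / cmod (?q ^ m)"
    unfolding norm_divide
    using cmod_integral_nth_deriv_osc_le_1 [OF f nf k] by (intro divide_right_mono) auto
  also have "cmod (?q ^ m) = (2 * pi * real_of_int \<bar>k\<bar>) ^ m"
    by (simp add: norm_power norm_mult)
  finally show "cmod (osc_integral k f -
      (\<Sum>i<m. 1 / ?q ^ Suc i * (nth_deriv i f 0 - nth_deriv i f 1)))
      \<le> 1 / (2 * pi * real_of_int \<bar>k\<bar>) ^ m" .
qed

section \<open>Upper bounds for the minimal errors\<close>

theorem mainTheorem15:
  shows "(\<forall>n::nat. n \<ge> 1 \<longrightarrow> minimal_error n 0 \<le> ereal (1 / (2 ^ (n - 1) * fact n))) \<and>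
    (\<forall>(k::int) (n::nat). k \<noteq> 0 \<and> even n \<and> n \<ge> 2 \<longrightarrow>
       minimal_error n k \<le>
         ereal (min (1 / (2 ^ (n - 1) * fact n)) (1 / (2 * pi * real_of_int \<bar>k\<bar>) ^ (n div 2))))"
proof (intro conjI allI impI)
  fix n :: nat assume "n \<ge> 1"
  then show "minimal_error n 0 \<le> ereal (1 / (2 ^ (n - 1) * fact n))"
    by (rule minimal_error_le_Taylor)
next
  fix k :: int and n :: nat assume *: "k \<noteq> 0 \<and> even n \<and> n \<ge> 2"
  have "minimal_error n k \<le> ereal (1 / (2 ^ (n - 1) * fact n))"
    using * by (intro minimal_error_le_Taylor) auto
  moreover have "minimal_error n k \<le> ereal (1 / (2 * pi * real_of_int \<bar>k\<bar>) ^ (n div 2))"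
    using minimal_error_le_by_parts [of k "n div 2"] * by simp
  ultimately show "minimal_error n k \<le>
      ereal (min (1 / (2 ^ (n - 1) * fact n)) (1 / (2 * pi * real_of_int \<bar>k\<bar>) ^ (n div 2)))"
    by (simp add: min_def)
qed

end
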